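(* Put $$m_n(x)=\int K(u)f_X(x-hu)\,du,$$ $$v_n(x)=\frac1M\Bigl\{\frac1h\int L(u)^2f_W(x-hu)\,du-m_n(x)^2\Bigr\},$$ $$w_n(x)=\frac{2N}{M^2}\Bigl\{\frac1h\int K(u)^2f_X(x-hu)\,du-m_n(x)^2\Bigr\}.$$ Then the mean and variance of $\check f_X(x)$ equal $m_n(x)$ and $v_n(x)$, respectively; the mean of $\tilde f_X(x)$ equals $m_n(x)$; and the variance of $\tilde f_X(x)$ equals $v_n(x)+w_n(x)$.
   Context: Model. One observes $W_{jk}=X_j+U_{jk}$ for $1\le k\le N_j$, $1\le j\le n$, where the $X_j$ are identically distributed as $X$ (density $f_X$), the $U_{jk}$ are identically distributed as $U$ (density $f_U$), and all the $X_j$'s and $U_{jk}$'s are totally independent. The $N_j$ are deterministic positive integers. $f_W$ is the density of $W=X+U$, with $X$ and $U$ independent. For a function $f$, $f^{\mathrm{Ft}}(t)=\int e^{itx}f(x)\,dx$. It is assumed throughout that $f_U^{\mathrm{Ft}}$ is real-valued and does not vanish at any point of the real line. Notation. $M=\sum_{j\le n}N_j$ and $N=\frac12\sum_{j\le n}N_j(N_j-1)$. $K$ is a symmetric kernel function (real-valued, integrable, $\int K=1$) whose Fourier transform $K^{\mathrm{Ft}}$ is bounded and compactly supported, $h>0$ is a bandwidth, and $$L(u)=\frac1{2\pi}\int e^{-itu}\frac{K^{\mathrm{Ft}}(t)}{f_U^{\mathrm{Ft}}(t/h)}\,dt,\qquad \tilde f_X(x)=\frac1{Mh}\sum_{j=1}^n\sum_{k=1}^{N_j}L\Bigl(\frac{x-W_{jk}}h\Bigr).$$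 $\check f_X$ denotes the standard (unreplicated) version of $\tilde f_X$ with sample size $M$: $\check f_X(x)=\frac1{Mh}\sum_{i=1}^M L\bigl(\frac{x-W_i}h\bigr)$, where $W_1,\dots,W_M$ are independent and identically distributed as $W=X+U$. *)

theory Defs
  imports "HOL-Probability.Probability"
begin

definition ft :: "(real \<Rightarrow> real) \<Rightarrow> real \<Rightarrow> complex" where
  "ft f t = (CLBINT x. iexp (t * x) * complex_of_real (f x))"

definition deconv_kernel_complex ::
    "(real \<Rightarrow> real) \<Rightarrow> (real \<Rightarrow> real) \<Rightarrow> real \<Rightarrow> real \<Rightarrow> complex" where
  "deconv_kernel_complex K fU h u =
     complex_of_real (1 / (2 * pi)) * (CLBINT t. iexp (- (t * u)) * (ft K t / ft fU (t / h)))"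

text \<open>
  For symmetric \<open>K\<close> and real-valued \<open>ft fU\<close> the complex integral above is a real number, see
  \<open>complex_of_real_deconv_kernel\<close> below. Hence taking the real part only changes the type.
\<close>

definition deconv_kernel ::
    "(real \<Rightarrow> real) \<Rightarrow> (real \<Rightarrow> real) \<Rightarrow> real \<Rightarrow> real \<Rightarrow> real" where
  "deconv_kernel K fU h u = Re (deconv_kernel_complex K fU h u)"

lemma ft_uminus: "ft f (- t) = cnj (ft f t)"
  unfolding ft_def by (simp add: Bochner_Integration.integral_cnj [symmetric] exp_cnj del: Bochner_Integration.integral_cnj)

lemma lborel_integral_reflect: "(CLBINT x. f (- x)) = (CLBINT x. f x)" for f :: "real \<Rightarrow> complex"
  using lborel_integral_real_affine [of "-1" f 0] by simp

lemma ft_uminus_symmetric: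
  assumes "\<And>u. K (- u) = K u"
  shows "ft K (- t) = ft K t"
  unfolding ft_def
  by (subst lborel_integral_reflect [symmetric]) (simp add: assms)

lemma complex_of_real_deconv_kernel:
  assumes K: "\<And>u. K (- u) = K u" and fU: "\<And>t. ft fU t \<in> \<real>"
  shows "complex_of_real (deconv_kernel K fU h u) = deconv_kernel_complex K fU h u"
proof -
  have cK: "cnj (ft K t) = ft K t" for t
    using ft_uminus [of K t] ft_uminus_symmetric [of K t, OF K] by simp
  have cU: "cnj (ft fU t) = ft fU t" for t
    using fU [of t] by (simp add: Reals_cnj_iff)
  have sU: "ft fU (- t) = ft fU t" for t
    using cU ft_uminus [of fU t] by simp
  have "cnj (CLBINT t. iexp (- (t * u)) * (ft K t / ft fU (t / h)))
      = (CLBINT t. iexp (- (- t * u)) * (ft K (- t) / ft fU (- t / h)))"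
    by (simp add: exp_cnj cK cU sU ft_uminus_symmetric [of K, OF K] Bochner_Integration.integral_cnj [symmetric] del: Bochner_Integration.integral_cnj)
  also have "\<dots> = (CLBINT t. iexp (- (t * u)) * (ft K t / ft fU (t / h)))"
    by (rule lborel_integral_reflect)
  finally have "cnj (deconv_kernel_complex K fU h u) = deconv_kernel_complex K fU h u"
    by (simp add: deconv_kernel_complex_def)
  then show ?thesis
    by (simp add: deconv_kernel_def Reals_cnj_iff [symmetric])
qed

definition total_obs :: "nat \<Rightarrow> (nat \<Rightarrow> nat) \<Rightarrow> nat" where
  "total_obs n N = (\<Sum>j=1..n. N j)"

definition total_pairs :: "nat \<Rightarrow> (nat \<Rightarrow> nat) \<Rightarrow> real" where
  "total_pairs n N = 1 / 2 * (\<Sum>j=1..n. real (N j) * (real (N j) - 1))"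

definition replicated_estimator ::
    "(real \<Rightarrow> real) \<Rightarrow> (real \<Rightarrow> real) \<Rightarrow> real \<Rightarrow> nat \<Rightarrow> (nat \<Rightarrow> nat) \<Rightarrow>
     (nat \<Rightarrow> nat \<Rightarrow> real) \<Rightarrow> real \<Rightarrow> real" where
  "replicated_estimator K fU h n N w x =
     1 / (real (total_obs n N) * h) *
       (\<Sum>j=1..n. \<Sum>k=1..N j. deconv_kernel K fU h ((x - w j k) / h))"

definition standard_estimator ::
    "(real \<Rightarrow> real) \<Rightarrow> (real \<Rightarrow> real) \<Rightarrow> real \<Rightarrow> nat \<Rightarrow> (nat \<Rightarrow> real) \<Rightarrow> real \<Rightarrow> real" where
  "standard_estimator K fU h m w x =
     1 / (real m * h) * (\<Sum>i=1..m. deconv_kernel K fU h ((x - w i) / h))"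

definition m_fun :: "(real \<Rightarrow> real) \<Rightarrow> (real \<Rightarrow> real) \<Rightarrow> real \<Rightarrow> real \<Rightarrow> real" where
  "m_fun K fX h x = (LBINT u. K u * fX (x - h * u))"

definition v_fun ::
    "(real \<Rightarrow> real) \<Rightarrow> (real \<Rightarrow> real) \<Rightarrow> (real \<Rightarrow> real) \<Rightarrow> (real \<Rightarrow> real) \<Rightarrow> real \<Rightarrow>
     nat \<Rightarrow> (nat \<Rightarrow> nat) \<Rightarrow> real \<Rightarrow> real" where
  "v_fun K fX fU fW h n N x =
     1 / real (total_obs n N) *
       (1 / h * (LBINT u. (deconv_kernel K fU h u)\<^sup>2 * fW (x - h * u)) - (m_fun K fX h x)\<^sup>2)"

definition w_fun ::
    "(real \<Rightarrow> real) \<Rightarrow> (real \<Rightarrow> real) \<Rightarrow> real \<Rightarrow> nat \<Rightarrow> (nat \<Rightarrow> nat) \<Rightarrow> real \<Rightarrow> real" where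
  "w_fun K fX h n N x =
     2 * total_pairs n N / (real (total_obs n N))\<^sup>2 *
       (1 / h * (LBINT u. (K u)\<^sup>2 * fX (x - h * u)) - (m_fun K fX h x)\<^sup>2)"

end

theory Submission
  imports Defs
begin

text \<open>
  Averaging \<open>L ((x - y - U) / h)\<close> over \<open>U\<close> multiplies the Fourier transform of \<open>L\<close> by
  \<open>ft fU (t / h)\<close>, which cancels the denominator, so by Fourier inversion the average is
  \<open>K ((x - y) / h)\<close> for almost every \<open>y\<close>. Hence conditioning on \<open>X j\<close> replaces \<open>L\<close> by \<open>K\<close>: every
  summand has mean \<open>h m\<^sub>n\<close>, and two replicates with the same \<open>X j\<close>, being conditionally independent,
  have mixed moment \<open>h \<integral> K(u)\<^sup>2 fX(x - h u) du\<close>. Summands with different indices \<open>j\<close> are independent.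

  Inversion for the signed integrable function \<open>K\<close> comes from Levy's inversion formula for
  probability measures: it identifies the integral of \<open>K\<close> over every interval with that of the
  inverse transform.
\<close>

subsection \<open>Fourier inversion for integrable functions\<close>

text \<open>The kernel of Levy's inversion formula. For \<open>t \<noteq> 0\<close> and
  \<open>a \<le> b\<close> it is the integral of \<open>iexp (- (t * v))\<close> over
  \<open>{a<..b}\<close>. At \<open>t = 0\<close> division by zero gives 0 instead of
  \<open>b - a\<close>, which matters only on a null set.\<close>

definition iexp_slope :: "real \<Rightarrow> real \<Rightarrow> real \<Rightarrow> complex" where
  "iexp_slope a b t = (iexp (- (t * a)) - iexp (- (t * b))) / (\<i> * complex_of_real t)"

lemma iexp_slope_measurable [measurable]: "iexp_slope a b \<in> borel_measurable borel"
  unfolding iexp_slope_def [abs_def] by measurable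

text \<open>The bound is uniform in \<open>t\<close>, so truncated integrals of the slope against a
  Fourier transform can be dominated. Negating and swapping the endpoints matches the sign
  convention of \<open>Levy_Inversion_aux2\<close>.\<close>

lemma norm_iexp_slope_le:
  assumes "a \<le> b"
  shows "cmod (iexp_slope a b t) \<le> b - a"
proof (cases "t = 0")
  case False
  have "iexp_slope a b t = (iexp (t * (- a)) - iexp (t * (- b))) / (\<i> * t)"
    by (simp add: iexp_slope_def)
  then show ?thesis
    using Levy_Inversion_aux2 [of "- b" "- a" t] assms False by simp
qed (use assms in \<open>simp add: iexp_slope_def\<close>)

section \<open>Elementary bounds and integrability for the Fourier transform\<close>

lemma borel_measurable_ft [measurable]:
  assumes [measurable]: "f \<in> borel_measurable borel"
  shows "ft f \<in> borel_measurable borel"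
  unfolding ft_def by measurable

lemma norm_ft_le: "cmod (ft f t) \<le> (LBINT x. \<bar>f x\<bar>)"
proof -
  have "cmod (ft f t) \<le> (LBINT x. cmod (iexp (t * x) * complex_of_real (f x)))"
    unfolding ft_def by (rule integral_norm_bound)
  then show ?thesis
    by (simp add: norm_mult)
qed

lemma integrable_iexp_times:
  assumes "integrable lborel f"
  shows "integrable lborel (\<lambda>x. iexp (t * x) * complex_of_real (f x))"
proof -
  note [measurable] = borel_measurable_integrable [OF assms]
  show ?thesis
    by (rule Bochner_Integration.integrable_bound [OF assms]) (auto simp: norm_mult)
qed

lemma ft_diff:
  assumes "integrable lborel f" "integrable lborel g"
  shows "ft (\<lambda>x. f x - g x) t = ft f t - ft g t"
  using Bochner_Integration.integral_diff
    [OF integrable_iexp_times [OF assms(1), of t] integrable_iexp_times [OF assms(2), of t]]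
  by (simp add: ft_def right_diff_distrib)

lemma char_density:
  assumes [measurable]: "f \<in> borel_measurable lborel" and "\<And>x. 0 \<le> f x"
  shows "char (density lborel (\<lambda>x. ennreal (f x))) t = ft f t"
  unfolding char_def ft_def using assms(2)
  by (subst integral_density) (auto simp: scaleR_conv_of_real mult.commute)

lemma set_integrable_iexp_slope_ft:
  assumes [measurable]: "f \<in> borel_measurable borel" and "a \<le> b"
  shows "complex_set_integrable lborel {- T<..<T} (\<lambda>t. iexp_slope a b t * ft f t)"
  unfolding set_integrable_def
proof (rule integrableI_bounded_set_indicator [where B = "(b - a) * (LBINT x. \<bar>f x\<bar>)"])
  show "AE t in lborel. t \<in> {- T<..<T} \<longrightarrow> cmod (iexp_slope a b t * ft f t) \<le> (b - a) * (LBINT x. \<bar>f x\<bar>)"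
    unfolding norm_mult using norm_iexp_slope_le [OF \<open>a \<le> b\<close>] norm_ft_le
    by (intro AE_I2 impI mult_mono) (use assms in auto)
  show "emeasure lborel {- T<..<T} < \<infinity>"
    by (rule emeasure_bounded_finite) simp
qed auto

text \<open>Dividing \<open>f\<close> by its integral \<open>c\<close> gives a probability density,
  to which Levy's formula applies; multiplying by \<open>c\<close> undoes the scaling. Levy's
  formula asks for endpoints without mass, which holds because the measure has a Lebesgue
  density.\<close>

lemma ft_interval_tendsto_nonneg:
  assumes f: "integrable lborel f" "\<And>x. 0 \<le> f x" and c: "(LBINT x. f x) \<noteq> 0" and ab: "a \<le> b"
  shows "(\<lambda>T::nat. 1 / (2 * pi) * (CLBINT t:{- real T<..<real T}. iexp_slope a b t * ft f t))
           \<longlonglongrightarrow> complex_of_real (LBINT x:{a<..b}. f x)"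
proof -
  define c where "c = (LBINT x. f x)"
  note [measurable] = borel_measurable_integrable [OF f(1)]
  have c0: "0 < c"
    using c f(2) Bochner_Integration.integral_nonneg [of lborel f] by (auto simp: c_def less_le)
  define g where "g x = f x / c" for x
  have g: "integrable lborel g" "\<And>x. 0 \<le> g x" "(LBINT x. g x) = 1"
    using f c0 by (auto simp: g_def [abs_def] c_def)
  note [measurable] = borel_measurable_integrable [OF g(1)]
  define M where "M = density lborel (\<lambda>x. ennreal (g x))"
  have "emeasure M (space M) = 1"
    using g by (simp add: M_def emeasure_density nn_integral_eq_integral)
  then interpret M: real_distribution M
    by (intro real_distribution.intro prob_spaceI real_distribution_axioms.intro)
       (auto simp: M_def)
  have meas: "measure M A = (LBINT x:A. g x)" if [measurable]: "A \<in> sets borel" for A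
  proof -
    have "emeasure M A = (\<integral>\<^sup>+x. ennreal (indicator A x *\<^sub>R g x) \<partial>lborel)"
      by (auto simp: M_def emeasure_density intro!: nn_integral_cong split: split_indicator)
    also have "\<dots> = ennreal (LBINT x:A. g x)"
      unfolding set_lebesgue_integral_def using g
      by (intro nn_integral_eq_integral integrable_mult_indicator) auto
    finally show ?thesis
      using g by (simp add: measure_def set_lebesgue_integral_def Bochner_Integration.integral_nonneg)
  qed
  have sing: "measure M {y} = 0" for y
  proof -
    have "(LBINT x:{y}. g x) = 0"
      unfolding set_lebesgue_integral_def using AE_lborel_singleton [of y]
      by (intro integral_eq_zero_AE) auto
    then show ?thesis by (simp add: meas)
  qed
  have ftg: "ft g t = ft f t / c" for t
    unfolding ft_def g_def by simp
  have "char M t = ft f t / c" for t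
    unfolding M_def by (subst char_density) (use g in \<open>auto simp: ftg\<close>)
  with M.Levy_Inversion [OF ab sing sing]
  have "(\<lambda>T::nat. 1 / (2 * pi) * (CLBINT t:{- real T<..<real T}. iexp_slope a b t * (ft f t / c)))
           \<longlonglongrightarrow> complex_of_real (LBINT x:{a<..b}. g x)"
    by (simp add: interval_lebesgue_integral_def meas iexp_slope_def)
  from tendsto_mult_left [OF this, of "complex_of_real c"] show ?thesis
    using c0 by (simp add: g_def)
qed

lemma ft_interval_tendsto:
  assumes f: "integrable lborel f" and ab: "a \<le> b"
  shows "(\<lambda>T::nat. 1 / (2 * pi) * (CLBINT t:{- real T<..<real T}. iexp_slope a b t * ft f t))
           \<longlonglongrightarrow> complex_of_real (LBINT x:{a<..b}. f x)"
proof -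
  \<comment> \<open>Adding a Gaussian to both parts of \<open>f\<close> keeps their integrals away from \<open>0\<close>, so both can be normalised.\<close>
  define g where "g = std_normal_density"
  define p where "p x = max 0 (f x) + g x" for x
  define q where "q x = max 0 (- f x) + g x" for x
  have g: "integrable lborel g" "(LBINT x. g x) = 1" "\<And>x. 0 \<le> g x"
    unfolding g_def by (auto intro: integrable_normal_density integral_normal_density)
  have p: "integrable lborel p" "\<And>x. 0 \<le> p x" and q: "integrable lborel q" "\<And>x. 0 \<le> q x"
    unfolding p_def q_def using f g by auto
  note [measurable] = borel_measurable_integrable [OF p(1)] borel_measurable_integrable [OF q(1)]
  have "1 \<le> (LBINT x. p x)" "1 \<le> (LBINT x. q x)"
    unfolding g(2) [symmetric] by (intro integral_mono p q g; simp add: p_def q_def)+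
  then have "(\<lambda>T::nat. 1 / (2 * pi) * (CLBINT t:{- real T<..<real T}. iexp_slope a b t * ft p t)
              - 1 / (2 * pi) * (CLBINT t:{- real T<..<real T}. iexp_slope a b t * ft q t))
           \<longlonglongrightarrow> complex_of_real (LBINT x:{a<..b}. p x) - complex_of_real (LBINT x:{a<..b}. q x)"
    by (intro tendsto_diff ft_interval_tendsto_nonneg p q ab) auto
  moreover have "f = (\<lambda>x. p x - q x)"
    by (auto simp: p_def q_def max_def)
  then have "ft f t = ft p t - ft q t" for t
    using ft_diff [OF p(1) q(1)] by simp
  moreover have "set_integrable lborel {a<..b} p" "set_integrable lborel {a<..b} q"
    unfolding set_integrable_def by (intro integrable_mult_indicator p(1) q(1); simp)+
  then have "(LBINT x:{a<..b}. f x) = (LBINT x:{a<..b}. p x) - (LBINT x:{a<..b}. q x)"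
    using set_integral_diff(2) [of lborel "{a<..b}" p q] by (simp add: \<open>f = (\<lambda>x. p x - q x)\<close>)
  ultimately show ?thesis
    using set_integrable_iexp_slope_ft [OF _ ab, of p] set_integrable_iexp_slope_ft [OF _ ab, of q]
    by (simp add: right_diff_distrib set_integral_diff flip: of_real_diff)
qed

section \<open>Recovering a function from its integrals over intervals\<close>

lemma iexp_slope_eq_integral:
  assumes "t \<noteq> 0" "a \<le> b"
  shows "(CLBINT v:{a<..b}. iexp (- (t * v))) = iexp_slope a b t"
proof -
  have deriv: "((\<lambda>v. iexp (- (t * v)) / (- \<i> * t)) has_vector_derivative iexp (- (t * v))) (at v within S)"
    for v :: real and S
  proof -
    \<comment> \<open>The antiderivative is differentiated as a function of a complex variable and
      then restricted to the real line.\<close>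
    have "((\<lambda>z. exp (\<i> * (- (t * z))) / (- \<i> * t)) has_field_derivative exp (\<i> * (- (t * v)))) (at (complex_of_real v))"
      using assms by (auto intro!: derivative_eq_intros simp: ac_simps)
    from has_vector_derivative_real_field [OF this] show ?thesis
      by simp
  qed
  have "(CLBINT v=a..b. iexp (- (t * v))) = iexp (- (t * b)) / (- \<i> * t) - iexp (- (t * a)) / (- \<i> * t)"
    using assms
    by (intro interval_integral_FTC_finite [where F = "\<lambda>v. iexp (- (t * v)) / (- \<i> * t)"] deriv)
       (auto intro!: continuous_intros)
  then show ?thesis
    using assms by (simp add: interval_integral_Ioc iexp_slope_def field_simps)
qed

text \<open>The positive and negative parts of \<open>f\<close> are densities of two measures that
  agree on half-open intervals. These form an intersection-stable generator of the Borel sets, so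
  the measures coincide, and densities are unique almost everywhere. Integrability is local because
  the inverse transform, to which this is applied, is only known to be bounded.\<close>

lemma AE_eq_0_if_interval_integrals_eq_0:
  fixes f :: "real \<Rightarrow> real"
  assumes int: "\<And>a b. set_integrable lborel {a<..b} f"
    and zero: "\<And>a b. a \<le> b \<Longrightarrow> (LBINT x:{a<..b}. f x) = 0"
    and [measurable]: "f \<in> borel_measurable borel"
  shows "AE x in lborel. f x = 0"
proof -
  \<comment> \<open>As \<open>ennreal\<close> truncates at \<open>0\<close>, these are the positive and the negative part of \<open>f\<close>.\<close>
  define P where "P = density lborel (\<lambda>x. ennreal (f x))"
  define N where "N = density lborel (\<lambda>x. ennreal (- f x))"
  have fin: "emeasure P {a<..b} < \<infinity>" "emeasure N {a<..b} < \<infinity>"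
    and eq: "emeasure P {a<..b} = emeasure N {a<..b}" for a b
  proof -
    let ?g = "\<lambda>x. indicator {a<..b} x *\<^sub>R f x"
    have P: "emeasure P {a<..b} = (\<integral>\<^sup>+x. ennreal (?g x) \<partial>lborel)"
      by (auto simp: P_def emeasure_density intro!: nn_integral_cong split: split_indicator)
    have N: "emeasure N {a<..b} = (\<integral>\<^sup>+x. ennreal (- ?g x) \<partial>lborel)"
      by (auto simp: N_def emeasure_density intro!: nn_integral_cong split: split_indicator)
    have g: "integrable lborel ?g"
      using int [of a b] by (simp add: set_integrable_def)
    then show PN: "emeasure P {a<..b} < \<infinity>" "emeasure N {a<..b} < \<infinity>"
      unfolding P N by (auto simp: real_integrable_def less_top)
    have "(LBINT x. ?g x) = 0"
    proof (cases "a \<le> b")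
      case True
      then show ?thesis using zero [of a b] by (simp add: set_lebesgue_integral_def)
    qed simp
    \<comment> \<open>The integral of \<open>?g\<close> is the difference of these two real numbers.
      Finiteness of both measures then lifts the equality back to \<open>ennreal\<close>.\<close>
    then have "enn2real (emeasure P {a<..b}) = enn2real (emeasure N {a<..b})"
      unfolding P N using real_lebesgue_integral_def [OF g] by simp
    then show "emeasure P {a<..b} = emeasure N {a<..b}"
      using PN by (metis ennreal_enn2real_if less_irrefl infinity_ennreal_def)
  qed
  let ?E = "range (\<lambda>(a, b). {a<..b::real})"
  let ?A = "\<lambda>n::nat. {- real n<..real n}"
  have UN: "(\<Union>i. ?A i) = UNIV"
  proof safe
    fix x :: real
    obtain n :: nat where "\<bar>x\<bar> < n"
      using reals_Archimedean2 by blast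
    then show "x \<in> (\<Union>i. ?A i)"
      by (auto intro!: exI [of _ n])
  qed simp
  have PN: "P = N"
  proof (rule measure_eqI_generator_eq)
    show "Int_stable ?E"
      by (auto simp: Int_stable_def)
    show "sets P = sigma_sets UNIV ?E" "sets N = sigma_sets UNIV ?E"
      unfolding P_def N_def by (simp_all add: borel_sigma_sets_Ioc)
    show "range ?A \<subseteq> ?E" by auto
    show "emeasure P (?A i) \<noteq> \<infinity>" for i
      using fin [of "- real i" "real i"] by simp
  qed (use UN eq in auto)
  have "sigma_finite_measure P"
    by standard (use fin UN in \<open>auto intro!: exI [of _ "range ?A"] simp: P_def less_top\<close>)
  then have "AE x in lborel. ennreal (f x) = ennreal (- f x)"
    using PN unfolding P_def N_def by (subst sigma_finite_density_unique [symmetric]) auto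
  \<comment> \<open>One of \<open>ennreal (f x)\<close> and \<open>ennreal (- f x)\<close> is always
    0, so their equality makes both vanish.\<close>
  then show ?thesis
  proof eventually_elim
    case (elim x)
    then show ?case
      by (cases "0 \<le> f x") (auto simp: ennreal_neg ennreal_eq_0_iff)
  qed
qed

text \<open>Integrability of \<open>ft f\<close> lets dominated convergence remove the truncation in
  Levy's formula. Writing the slope as an integral over \<open>{a<..b}\<close> and exchanging
  integrals turns the limit into the integral of the inverse transform \<open>k\<close> over that
  interval.\<close>

theorem ft_inversion_AE:
  assumes f: "integrable lborel f" and ft: "integrable lborel (ft f)"
  shows "AE v in lborel. complex_of_real (f v) = 1 / (2 * pi) * (CLBINT t. iexp (- (t * v)) * ft f t)"
proof -
  note [measurable] = borel_measurable_integrable [OF f]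
  define k where "k v = complex_of_real (1 / (2 * pi)) * (CLBINT t. iexp (- (t * v)) * ft f t)" for v
  have k_meas [measurable]: "k \<in> borel_measurable borel"
    unfolding k_def by measurable
  have k_bound: "cmod (k v) \<le> 1 / (2 * pi) * (LBINT t. cmod (ft f t))" for v
    unfolding k_def norm_mult
    by (intro mult_mono order.trans [OF integral_norm_bound] integral_mono')
       (auto simp: norm_mult norm_divide ft)
  have k_int: "set_integrable lborel {a<..b} k" for a b
    unfolding set_integrable_def using k_bound
    by (intro integrableI_bounded_set_indicator emeasure_bounded_finite) auto
  have f_int: "set_integrable lborel {a<..b} (\<lambda>v. complex_of_real (f v))" for a b
    unfolding set_integrable_def by (intro integrable_mult_indicator) (use f in auto)
  define d where "d v = complex_of_real (f v) - k v" for v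
  have d_int: "set_integrable lborel {a<..b} d" for a b
    unfolding d_def using f_int k_int by (rule set_integral_diff(1))
  have d0: "(CLBINT v:{a<..b}. d v) = 0" if ab: "a \<le> b" for a b
  proof -
    let ?F = "\<lambda>t. iexp_slope a b t * ft f t"
    have "(\<lambda>T::nat. CLBINT t:{- real T<..<real T}. ?F t) \<longlonglongrightarrow> (CLBINT t. ?F t)"
      unfolding set_lebesgue_integral_def
    proof (rule integral_dominated_convergence [where w = "\<lambda>t. (b - a) * cmod (ft f t)"])
      show "AE t in lborel. (\<lambda>T::nat. indicator {- real T<..<real T} t *\<^sub>R ?F t) \<longlonglongrightarrow> ?F t"
      proof (intro AE_I2 tendsto_eventually)
        fix t :: real
        obtain n :: nat where n: "\<bar>t\<bar> < n"
          using reals_Archimedean2 by blast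
        show "\<forall>\<^sub>F T::nat in sequentially. indicator {- real T<..<real T} t *\<^sub>R ?F t = ?F t"
          using eventually_ge_at_top [of n] by eventually_elim (use n in \<open>auto split: split_indicator\<close>)
      qed
      show "AE t in lborel. cmod (indicator {- real T<..<real T} t *\<^sub>R ?F t) \<le> (b - a) * cmod (ft f t)" for T :: nat
        using norm_iexp_slope_le [OF ab] ab
        by (intro AE_I2) (auto simp: norm_mult intro!: mult_right_mono split: split_indicator)
    qed (use ft in auto)
    then have "(\<lambda>T::nat. 1 / (2 * pi) * (CLBINT t:{- real T<..<real T}. ?F t))
        \<longlonglongrightarrow> complex_of_real (1 / (2 * pi)) * (CLBINT t. ?F t)"
      by (intro tendsto_mult_left)
    with ft_interval_tendsto [OF f ab]
    have *: "complex_of_real (LBINT x:{a<..b}. f x) = complex_of_real (1 / (2 * pi)) * (CLBINT t. ?F t)"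
      by (rule LIMSEQ_unique)
    \<comment> \<open>The two integrands may differ at \<open>t = 0\<close>, where the slope has its
      default value.\<close>
    have "(CLBINT t. ?F t) = (CLBINT t. (CLBINT v. indicator {a<..b} v *\<^sub>R (iexp (- (t * v)) * ft f t)))"
    proof (rule integral_cong_AE)
      show "AE t in lborel. ?F t = (CLBINT v. indicator {a<..b} v *\<^sub>R (iexp (- (t * v)) * ft f t))"
        using AE_lborel_singleton [of 0]
      proof eventually_elim
        case (elim t)
        then show ?case
          using iexp_slope_eq_integral [OF elim ab]
          by (simp add: set_lebesgue_integral_def flip: mult_scaleR_left)
      qed
    qed auto
    also have "\<dots> = (CLBINT v. (CLBINT t. indicator {a<..b} v *\<^sub>R (iexp (- (t * v)) * ft f t)))"
    proof (rule lborel_pair.Fubini_integral)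
      have "integrable (lborel \<Otimes>\<^sub>M lborel) (\<lambda>(v, t). indicator {a<..b} v *\<^sub>R cmod (ft f t))"
        using ab by (intro lborel_pair.Fubini_integrable) (auto simp: ft split_beta')
      then show "integrable (lborel \<Otimes>\<^sub>M lborel) (\<lambda>(v, t). indicator {a<..b} v *\<^sub>R (iexp (- (t * v)) * ft f t))"
        by (rule Bochner_Integration.integrable_bound)
           (auto simp: norm_mult split: split_indicator)
    qed
    also have "complex_of_real (1 / (2 * pi)) * \<dots> = (CLBINT v:{a<..b}. k v)"
      unfolding k_def set_lebesgue_integral_def
      by (subst integral_mult_right_zero [symmetric]) (simp only: integral_scaleR_right mult_scaleR_right)
    finally have "complex_of_real (LBINT x:{a<..b}. f x) = (CLBINT v:{a<..b}. k v)"
      using * by simp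
    then show ?thesis
      unfolding d_def
      by (subst set_integral_diff(2) [OF f_int k_int]) (simp add: set_integral_complex_of_real)
  qed
  have d_meas [measurable]: "d \<in> borel_measurable borel"
    unfolding d_def by measurable
  \<comment> \<open>The vanishing criterion is for real functions, so real and imaginary parts are
    treated separately.\<close>
  have "AE v in lborel. Re (d v) = 0"
  proof (rule AE_eq_0_if_interval_integrals_eq_0)
    show "set_integrable lborel {a<..b} (\<lambda>v. Re (d v))" for a b
      using d_int [of a b] integrable_Re unfolding set_integrable_def by fastforce
    show "(LBINT v:{a<..b}. Re (d v)) = 0" if "a \<le> b" for a b
      using d0 [OF that] integral_Re [OF d_int [of a b, unfolded set_integrable_def]]
      by (simp add: set_lebesgue_integral_def)
  qed auto
  moreover have "AE v in lborel. Im (d v) = 0"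
  proof (rule AE_eq_0_if_interval_integrals_eq_0)
    show "set_integrable lborel {a<..b} (\<lambda>v. Im (d v))" for a b
      using d_int [of a b] integrable_Im unfolding set_integrable_def by fastforce
    show "(LBINT v:{a<..b}. Im (d v)) = 0" if "a \<le> b" for a b
      using d0 [OF that] integral_Im [OF d_int [of a b, unfolded set_integrable_def]]
      by (simp add: set_lebesgue_integral_def)
  qed auto
  ultimately show ?thesis
    by eventually_elim (simp add: d_def k_def complex_eq_iff)
qed

text \<open>The bound is asked for only on the closed support, since compactness controls the
  reciprocal of \<open>ft fU (t / h)\<close> only there.\<close>

lemma integrable_if_bounded_compact_support:
  fixes g :: "real \<Rightarrow> complex"
  assumes [measurable]: "g \<in> borel_measurable borel" and "compact (closure {t. g t \<noteq> 0})"
    and "\<And>t. t \<in> closure {t. g t \<noteq> 0} \<Longrightarrow> cmod (g t) \<le> B"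
  shows "integrable lborel g"
proof (rule integrableI_bounded_set [where A = "closure {t. g t \<noteq> 0}" and B = B])
  show "emeasure lborel (closure {t. g t \<noteq> 0}) < \<infinity>"
    using assms(2) by (intro emeasure_bounded_finite compact_imp_bounded)
  show "AE t in lborel. t \<notin> closure {t. g t \<noteq> 0} \<longrightarrow> g t = 0"
    using closure_subset [of "{t. g t \<noteq> 0}"] by auto
qed (use assms in auto)

subsection \<open>The deconvolution kernel\<close>

lemma deconv_kernel_measurable [measurable]:
  assumes [measurable]: "K \<in> borel_measurable borel" "fU \<in> borel_measurable borel"
  shows "deconv_kernel K fU h \<in> borel_measurable borel"
  unfolding deconv_kernel_def [abs_def] deconv_kernel_complex_def [abs_def] by measurable

text \<open>The bound is free of \<open>u\<close>, so the summands of both estimators are uniformly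
  bounded and all their moments exist.\<close>

lemma abs_deconv_kernel_le:
  "\<bar>deconv_kernel K fU h u\<bar> \<le> 1 / (2 * pi) * (LBINT t. cmod (ft K t / ft fU (t / h)))"
proof -
  have "\<bar>deconv_kernel K fU h u\<bar> \<le> cmod (deconv_kernel_complex K fU h u)"
    unfolding deconv_kernel_def by (rule abs_Re_le_cmod)
  also have "\<dots> = 1 / (2 * pi) * cmod (CLBINT t. iexp (- (t * u)) * (ft K t / ft fU (t / h)))"
    unfolding deconv_kernel_complex_def by (simp add: norm_mult norm_divide)
  also have "\<dots> \<le> 1 / (2 * pi) * (LBINT t. cmod (iexp (- (t * u)) * (ft K t / ft fU (t / h))))"
    by (intro mult_left_mono integral_norm_bound) simp
  finally show ?thesis
    by (simp add: norm_mult norm_divide)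
qed

context
  fixes K fU :: "real \<Rightarrow> real" and h :: real
  assumes K: "integrable lborel K" "compact (closure {t. ft K t \<noteq> 0})"
    and fU: "fU \<in> borel_measurable borel" "\<And>y. 0 \<le> fU y"
    and fU_prob: "prob_space (density lborel (\<lambda>y. ennreal (fU y)))"
    and fU_ft: "\<And>t. ft fU t \<noteq> 0" and h: "0 < h"
begin

lemma real_distribution_fU: "real_distribution (density lborel (\<lambda>y. ennreal (fU y)))"
  using fU_prob by (simp add: real_distribution_def real_distribution_axioms_def)

lemma char_fU: "char (density lborel (\<lambda>y. ennreal (fU y))) t = ft fU t"
  using fU by (intro char_density) auto

lemma integrable_ft_K: "integrable lborel (ft K)"
  using K norm_ft_le [of K] borel_measurable_integrable [OF K(1)]
  by (intro integrable_if_bounded_compact_support) auto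

text \<open>A characteristic function is continuous; having no zero, its reciprocal is bounded on
  the compact support of \<open>ft K\<close>. The numerator is bounded by the L1 norm of
  \<open>K\<close>.\<close>

lemma integrable_ft_quotient: "integrable lborel (\<lambda>t. ft K t / ft fU (t / h))"
proof -
  note [measurable] = fU(1) borel_measurable_integrable [OF K(1)]
  let ?S = "closure {t. ft K t \<noteq> 0}"
  have supp: "{t. ft K t / ft fU (t / h) \<noteq> 0} = {t. ft K t \<noteq> 0}"
    using fU_ft by simp
  have "ft fU = char (density lborel (\<lambda>y. ennreal (fU y)))"
    using char_fU by auto
  then have cont: "isCont (ft fU) t" for t
    using real_distribution.isCont_char [OF real_distribution_fU] by simp
  have "continuous_on ?S (\<lambda>t. inverse (ft fU (t / h)))"
    using fU_ft h
    by (intro continuous_at_imp_continuous_on ballI continuous_intros isCont_o2 [OF _ cont]) auto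
  then have "bounded ((\<lambda>t. inverse (ft fU (t / h))) ` ?S)"
    using K(2) by (intro compact_imp_bounded compact_continuous_image)
  then obtain C where C: "\<And>t. t \<in> ?S \<Longrightarrow> cmod (inverse (ft fU (t / h))) \<le> C"
    by (auto simp: bounded_iff)
  show ?thesis
  proof (rule integrable_if_bounded_compact_support [where B = "(LBINT x. \<bar>K x\<bar>) * C"], unfold supp)
    fix t assume "t \<in> ?S"
    then show "cmod (ft K t / ft fU (t / h)) \<le> (LBINT x. \<bar>K x\<bar>) * C"
      unfolding divide_inverse [where 'a = complex] norm_mult using norm_ft_le [of K t] C by (intro mult_mono) auto
  qed (use K in auto)
qed

text \<open>This holds at every \<open>s\<close>; exceptional null sets enter only with Fourier
  inversion. Fubini applies because the integrand has modulus \<open>cmod (\<phi> t)\<close>,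
  whatever \<open>u\<close> is. The factor \<open>iexp (t / h * u)\<close> then integrates to the
  denominator of \<open>\<phi> t\<close>.\<close>

lemma smoothed_deconv_kernel_eq:
  "(LINT u|density lborel (\<lambda>y. ennreal (fU y)). deconv_kernel K fU h (s - u / h))
     = Re (complex_of_real (1 / (2 * pi)) * (CLBINT t. iexp (- (t * s)) * ft K t))"
proof -
  define \<mu> where "\<mu> = density lborel (\<lambda>y. ennreal (fU y))"
  define \<phi> where "\<phi> t = ft K t / ft fU (t / h)" for t
  interpret \<mu>: real_distribution \<mu>
    using real_distribution_fU by (simp add: \<mu>_def)
  interpret P: pair_sigma_finite lborel \<mu> ..
  note [measurable] = fU(1) borel_measurable_integrable [OF K(1)]
  have \<phi>: "integrable lborel \<phi>"
    using integrable_ft_quotient by (simp add: \<phi>_def [abs_def])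
  note [measurable] = borel_measurable_integrable [OF \<phi>]
  define c where "c = complex_of_real (1 / (2 * pi))"
  have int: "integrable (lborel \<Otimes>\<^sub>M \<mu>) (\<lambda>(t, u). iexp (- (t * (s - u / h))) * \<phi> t)"
  proof -
    have "integrable (lborel \<Otimes>\<^sub>M \<mu>) (\<lambda>(t, u). cmod (\<phi> t))"
      by (intro P.Fubini_integrable) (auto simp: \<phi> split_beta')
    then show ?thesis
      by (rule Bochner_Integration.integrable_bound) (auto simp: norm_mult)
  qed
  have "(LINT u|\<mu>. deconv_kernel K fU h (s - u / h))
      = (LINT u|\<mu>. Re (c * (CLBINT t. iexp (- (t * (s - u / h))) * \<phi> t)))"
    by (simp add: deconv_kernel_def deconv_kernel_complex_def \<phi>_def c_def)
  also have "\<dots> = Re (CLINT u|\<mu>. c * (CLBINT t. iexp (- (t * (s - u / h))) * \<phi> t))"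
    using P.integrable_snd [OF int] by (intro integral_Re integrable_mult_right) simp
  also have "(CLINT u|\<mu>. c * (CLBINT t. iexp (- (t * (s - u / h))) * \<phi> t))
      = c * (CLBINT t. (CLINT u|\<mu>. iexp (- (t * (s - u / h))) * \<phi> t))"
    using P.Fubini_integral [OF int] by simp
  also have "(CLBINT t. (CLINT u|\<mu>. iexp (- (t * (s - u / h))) * \<phi> t))
      = (CLBINT t. iexp (- (t * s)) * ft K t)"
  proof (rule Bochner_Integration.integral_cong [OF refl])
    fix t :: real
    have "(CLINT u|\<mu>. iexp (- (t * (s - u / h))) * \<phi> t)
        = (CLINT u|\<mu>. iexp (- (t * s)) * \<phi> t * iexp (t / h * u))"
      by (intro Bochner_Integration.integral_cong refl)
         (simp add: algebra_simps flip: exp_add)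
    also have "\<dots> = iexp (- (t * s)) * \<phi> t * char \<mu> (t / h)"
      unfolding char_def by simp
    also have "\<dots> = iexp (- (t * s)) * ft K t"
      using fU_ft by (simp add: \<phi>_def \<mu>_def char_fU)
    finally show "(CLINT u|\<mu>. iexp (- (t * (s - u / h))) * \<phi> t) = iexp (- (t * s)) * ft K t" .
  qed
  finally show ?thesis
    by (simp add: \<mu>_def c_def)
qed

lemma smoothed_deconv_kernel_AE:
  "AE y in lborel. (LINT u|density lborel (\<lambda>y. ennreal (fU y)).
     deconv_kernel K fU h ((x - (y + u)) / h)) = K ((x - y) / h)"
proof -
  note [measurable] = fU(1) borel_measurable_integrable [OF K(1)]
  let ?G = "\<lambda>s. Re (complex_of_real (1 / (2 * pi)) * (CLBINT t. iexp (- (t * s)) * ft K t))"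
  have "AE s in lborel. complex_of_real (K s) = complex_of_real (1 / (2 * pi)) * (CLBINT t. iexp (- (t * s)) * ft K t)"
    using ft_inversion_AE [OF K(1) integrable_ft_K] by simp
  then have "AE s in lborel. ?G s = K s"
    by eventually_elim (metis Re_complex_of_real)
  moreover have "Measurable.pred borel (\<lambda>s. ?G s = K s)"
    by measurable
  \<comment> \<open>The affine map from \<open>y\<close> to \<open>(x - y) / h\<close> has nonzero
    slope, so it pulls null sets back to null sets.\<close>
  ultimately have "AE y in lborel. ?G (x / h + (- 1 / h) * y) = K (x / h + (- 1 / h) * y)"
    using h by (intro AE_borel_affine [where P = "\<lambda>s. ?G s = K s"]) auto
  then show ?thesis
  proof eventually_elim
    case (elim y)
    have "(x - (y + u)) / h = (x / h + (- 1 / h) * y) - u / h" for u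
      by (simp add: diff_divide_distrib add_divide_distrib)
    moreover have "(x - y) / h = x / h + (- 1 / h) * y"
      by (simp add: diff_divide_distrib)
    ultimately show ?case
      using elim by (simp only: smoothed_deconv_kernel_eq)
  qed
qed

end

lemma lborel_integral_rescale:
  fixes f g :: "real \<Rightarrow> real"
  assumes "0 < h"
  shows "(LBINT y. g ((x - y) / h) * f y) = h * (LBINT u. g u * f (x - h * u))"
  using lborel_integral_real_affine [of "- h" "\<lambda>y. g ((x - y) / h) * f y" x] assms by simp

subsection \<open>Moments of sums and conditioning on an independent variable\<close>

text \<open>Conditioning on \<open>X\<close> by Fubini for the product law: \<open>X\<close> is
  frozen and only \<open>Y\<close> is averaged. Both variables have values in one type, as
  \<open>indep_var\<close> demands.\<close>

lemma (in prob_space) expectation_indep_var: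
  fixes g :: "'b \<times> 'b \<Rightarrow> real"
  assumes indep: "indep_var S X T Y" and g [measurable]: "g \<in> borel_measurable (S \<Otimes>\<^sub>M T)"
    and bound: "\<And>p. \<bar>g p\<bar> \<le> B"
  shows "expectation (\<lambda>\<omega>. g (X \<omega>, Y \<omega>)) = expectation (\<lambda>\<omega>. expectation (\<lambda>\<omega>'. g (X \<omega>, Y \<omega>')))"
proof -
  have [measurable]: "random_variable S X" "random_variable T Y"
    and eq: "distr M S X \<Otimes>\<^sub>M distr M T Y = distr M (S \<Otimes>\<^sub>M T) (\<lambda>\<omega>. (X \<omega>, Y \<omega>))"
    using indep by (auto simp: indep_var_distribution_eq)
  interpret X: prob_space "distr M S X" by (rule prob_space_distr) simp
  interpret Y: prob_space "distr M T Y" by (rule prob_space_distr) simp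
  interpret XY: pair_prob_space "distr M S X" "distr M T Y" ..
  have "expectation (\<lambda>\<omega>. g (X \<omega>, Y \<omega>)) = (\<integral>p. g p \<partial>(distr M S X \<Otimes>\<^sub>M distr M T Y))"
    unfolding eq by (subst integral_distr) auto
  also have "\<dots> = (\<integral>s. (\<integral>t. g (s, t) \<partial>distr M T Y) \<partial>distr M S X)"
    using bound by (intro XY.integral_fst' [symmetric] XY.P.integrable_const_bound [where B = B]) auto
  also have "\<dots> = expectation (\<lambda>\<omega>. (\<integral>t. g (X \<omega>, t) \<partial>distr M T Y))"
    by (rule integral_distr) measurable
  also have "\<dots> = expectation (\<lambda>\<omega>. expectation (\<lambda>\<omega>'. g (X \<omega>, Y \<omega>')))"
  proof (rule Bochner_Integration.integral_cong [OF refl])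
    fix \<omega> assume "\<omega> \<in> space M"
    then have [measurable]: "X \<omega> \<in> space S"
      by (rule measurable_space [OF \<open>random_variable S X\<close>])
    show "(\<integral>t. g (X \<omega>, t) \<partial>distr M T Y) = expectation (\<lambda>\<omega>'. g (X \<omega>, Y \<omega>'))"
      by (rule integral_distr) measurable
  qed
  finally show ?thesis .
qed

lemma (in prob_space) expectation_indep_sum:
  fixes X Y \<psi> :: "_ \<Rightarrow> real"
  assumes indep: "indep_var borel X borel Y" and [measurable]: "\<psi> \<in> borel_measurable borel"
    and bound: "\<And>w. \<bar>\<psi> w\<bar> \<le> B"
  shows "expectation (\<lambda>\<omega>. \<psi> (X \<omega> + Y \<omega>))
    = (\<integral>y. (\<integral>u. \<psi> (y + u) \<partial>distr M borel Y) \<partial>distr M borel X)"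
proof -
  have [measurable]: "random_variable borel X" "random_variable borel Y"
    using indep by (auto simp: indep_var_distribution_eq)
  interpret Y: prob_space "distr M borel Y" by (rule prob_space_distr) simp
  have "expectation (\<lambda>\<omega>. \<psi> (X \<omega> + Y \<omega>)) = expectation (\<lambda>\<omega>. expectation (\<lambda>\<omega>'. \<psi> (X \<omega> + Y \<omega>')))"
    using expectation_indep_var [OF indep, of "\<lambda>(a, b). \<psi> (a + b)" B] bound by (simp add: split_beta)
  also have "\<dots> = expectation (\<lambda>\<omega>. (\<integral>u. \<psi> (X \<omega> + u) \<partial>distr M borel Y))"
    by (intro Bochner_Integration.integral_cong refl integral_distr [symmetric]) measurable
  also have "\<dots> = (\<integral>y. (\<integral>u. \<psi> (y + u) \<partial>distr M borel Y) \<partial>distr M borel X)"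
    by (rule integral_distr [symmetric]) measurable
  finally show ?thesis .
qed

text \<open>Disjoint blocks of an independent family are independent. The indices inside a block may
  coincide, so that a single variable can be doubled to match the type of a pair.\<close>

lemma (in prob_space) indep_var_pairs:
  assumes "indep_vars (\<lambda>_. N) V I" "{a, b} \<subseteq> I" "{c, d} \<subseteq> I" "{a, b} \<inter> {c, d} = {}"
  shows "indep_var (N \<Otimes>\<^sub>M N) (\<lambda>\<omega>. (V a \<omega>, V b \<omega>)) (N \<Otimes>\<^sub>M N) (\<lambda>\<omega>. (V c \<omega>, V d \<omega>))"
proof -
  have "indep_var (PiM {a, b} (\<lambda>_. N)) (\<lambda>\<omega>. restrict (\<lambda>i. V i \<omega>) {a, b})
                  (PiM {c, d} (\<lambda>_. N)) (\<lambda>\<omega>. restrict (\<lambda>i. V i \<omega>) {c, d})"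
    using assms by (intro indep_var_restrict)
  then have "indep_var (N \<Otimes>\<^sub>M N) ((\<lambda>f. (f a, f b)) \<circ> (\<lambda>\<omega>. restrict (\<lambda>i. V i \<omega>) {a, b}))
                       (N \<Otimes>\<^sub>M N) ((\<lambda>f. (f c, f d)) \<circ> (\<lambda>\<omega>. restrict (\<lambda>i. V i \<omega>) {c, d}))"
    by (rule indep_var_compose) measurable
  then show ?thesis
    by (simp add: comp_def)
qed

lemma (in prob_space) indep_var_of_indep_vars:
  assumes "indep_vars (\<lambda>_. N) V I" "i \<in> I" "j \<in> I" "i \<noteq> j"
  shows "indep_var N (V i) N (V j)"
proof -
  have "indep_var N (fst \<circ> (\<lambda>\<omega>. (V i \<omega>, V i \<omega>))) N (fst \<circ> (\<lambda>\<omega>. (V j \<omega>, V j \<omega>)))"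
    using indep_var_pairs [OF assms(1), of i i j j] assms(2-4)
    by (intro indep_var_compose [of "N \<Otimes>\<^sub>M N" _ "N \<Otimes>\<^sub>M N"]) auto
  then show ?thesis
    by (simp add: comp_def)
qed

text \<open>This reduces both estimators to mixed moments of their summands. Since all means equal
  \<open>e\<close>, each term of the double sum is a covariance; boundedness supplies every
  integrability.\<close>

lemma (in prob_space) scaled_sum_moments:
  fixes Z :: "'i \<Rightarrow> 'a \<Rightarrow> real" and c e :: real
  assumes I: "finite I" and [measurable]: "\<And>i. i \<in> I \<Longrightarrow> random_variable borel (Z i)"
    and bound: "\<And>i \<omega>. i \<in> I \<Longrightarrow> \<bar>Z i \<omega>\<bar> \<le> B"
    and mean: "\<And>i. i \<in> I \<Longrightarrow> expectation (Z i) = e"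
  shows "integrable M (\<lambda>\<omega>. c * (\<Sum>i\<in>I. Z i \<omega>))"
    and "integrable M (\<lambda>\<omega>. (c * (\<Sum>i\<in>I. Z i \<omega>))\<^sup>2)"
    and "expectation (\<lambda>\<omega>. c * (\<Sum>i\<in>I. Z i \<omega>)) = c * (card I * e)"
    and "variance (\<lambda>\<omega>. c * (\<Sum>i\<in>I. Z i \<omega>))
           = c\<^sup>2 * (\<Sum>i\<in>I. \<Sum>j\<in>I. expectation (\<lambda>\<omega>. Z i \<omega> * Z j \<omega>) - e\<^sup>2)"
proof -
  let ?S = "\<lambda>\<omega>. c * (\<Sum>i\<in>I. Z i \<omega>)"
  have Z: "integrable M (Z i)" if "i \<in> I" for i
    using that bound by (intro integrable_const_bound [where B = B]) auto
  have ZZ: "integrable M (\<lambda>\<omega>. Z i \<omega> * Z j \<omega>)" if "i \<in> I" "j \<in> I" for i j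
  proof (rule integrable_const_bound [where B = "B * B"])
    have "\<bar>Z i \<omega> * Z j \<omega>\<bar> \<le> B * B" for \<omega>
      unfolding abs_mult using bound that order.trans [OF abs_ge_zero bound [OF that(1)]]
      by (intro mult_mono) auto
    then show "AE \<omega> in M. norm (Z i \<omega> * Z j \<omega>) \<le> B * B"
      by simp
  qed (use that in measurable)
  have sq: "(\<lambda>\<omega>. (?S \<omega>)\<^sup>2) = (\<lambda>\<omega>. c\<^sup>2 * (\<Sum>i\<in>I. \<Sum>j\<in>I. Z i \<omega> * Z j \<omega>))"
    by (simp add: power2_eq_square sum_product ac_simps)
  show S: "integrable M ?S"
    using Z by (intro integrable_mult_right Bochner_Integration.integrable_sum)
  show S2: "integrable M (\<lambda>\<omega>. (?S \<omega>)\<^sup>2)"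
    unfolding sq using ZZ by (intro integrable_mult_right Bochner_Integration.integrable_sum)
  show ES: "expectation ?S = c * (card I * e)"
    using Z mean by (simp add: Bochner_Integration.integral_sum)
  have ES2: "expectation (\<lambda>\<omega>. (?S \<omega>)\<^sup>2) = c\<^sup>2 * (\<Sum>i\<in>I. \<Sum>j\<in>I. expectation (\<lambda>\<omega>. Z i \<omega> * Z j \<omega>))"
    unfolding sq using ZZ by (simp add: Bochner_Integration.integral_sum Bochner_Integration.integrable_sum)
  have "variance ?S = expectation (\<lambda>\<omega>. (?S \<omega>)\<^sup>2) - (expectation ?S)\<^sup>2"
    by (rule variance_eq [OF S S2])
  also have "\<dots> = c\<^sup>2 * (\<Sum>i\<in>I. \<Sum>j\<in>I. expectation (\<lambda>\<omega>. Z i \<omega> * Z j \<omega>) - e\<^sup>2)"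
    unfolding ES ES2 by (simp add: sum_subtractf power2_eq_square algebra_simps)
  finally show "variance ?S = c\<^sup>2 * (\<Sum>i\<in>I. \<Sum>j\<in>I. expectation (\<lambda>\<omega>. Z i \<omega> * Z j \<omega>) - e\<^sup>2)" .
qed

subsection \<open>The moments of the two estimators\<close>

text \<open>\<open>R\<close> carries the generic pair, \<open>P\<close> the replicated sample and
  \<open>Q\<close> the unreplicated one. Total independence is one \<open>indep_vars\<close> over
  the disjoint sum of the two index sets. The integrability conjuncts ensure that means and
  variances are genuine, not default values of Bochner integrals.\<close>

theorem theorem3p4:
  fixes R :: "'r measure" and P :: "'p measure" and Q :: "'q measure"
    and X\<^sub>0 U\<^sub>0 :: "'r \<Rightarrow> real"
    and fX fU fW K :: "real \<Rightarrow> real" and h x :: real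
    and n :: nat and N :: "nat \<Rightarrow> nat"
    and X :: "nat \<Rightarrow> 'p \<Rightarrow> real" and U :: "nat \<Rightarrow> nat \<Rightarrow> 'p \<Rightarrow> real"
    and W :: "nat \<Rightarrow> 'q \<Rightarrow> real"
  defines "f_check \<equiv> \<lambda>\<omega>. standard_estimator K fU h (total_obs n N) (\<lambda>i. W i \<omega>) x"
    and "f_tilde \<equiv> \<lambda>\<omega>. replicated_estimator K fU h n N (\<lambda>j k. X j \<omega> + U j k \<omega>) x"
  assumes R: "prob_space R"
    and fX: "\<And>y. 0 \<le> fX y" "distributed R lborel X\<^sub>0 (\<lambda>y. ennreal (fX y))"
    and fU: "\<And>y. 0 \<le> fU y" "distributed R lborel U\<^sub>0 (\<lambda>y. ennreal (fU y))"
    and indep: "prob_space.indep_var R borel X\<^sub>0 borel U\<^sub>0"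
    and fW: "\<And>y. 0 \<le> fW y" "distributed R lborel (\<lambda>\<omega>. X\<^sub>0 \<omega> + U\<^sub>0 \<omega>) (\<lambda>y. ennreal (fW y))"
    and fU_ft: "\<And>t. ft fU t \<in> \<real>" "\<And>t. ft fU t \<noteq> 0"
    and K: "integrable lborel K" "\<And>u. K (- u) = K u" "(LBINT u. K u) = 1"
    and K_ft: "bounded (range (ft K))" "compact (closure {t. ft K t \<noteq> 0})"
    and h: "0 < h"
    and n: "1 \<le> n" and N: "\<And>j. j \<in> {1..n} \<Longrightarrow> 1 \<le> N j"
    and P: "prob_space P"
    and X: "\<And>j. j \<in> {1..n} \<Longrightarrow> distr P borel (X j) = distr R borel X\<^sub>0"
    and U: "\<And>j k. j \<in> {1..n} \<Longrightarrow> k \<in> {1..N j} \<Longrightarrow> distr P borel (U j k) = distr R borel U\<^sub>0"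
    and XU: "prob_space.indep_vars P (\<lambda>_. borel) (case_sum X (\<lambda>(j, k). U j k))
               ({1..n} <+> (SIGMA j:{1..n}. {1..N j}))"
    and Q: "prob_space Q"
    and W: "\<And>i. i \<in> {1..total_obs n N} \<Longrightarrow>
               distr Q borel (W i) = distr R borel (\<lambda>\<omega>. X\<^sub>0 \<omega> + U\<^sub>0 \<omega>)"
    and W_indep: "prob_space.indep_vars Q (\<lambda>_. borel) W {1..total_obs n N}"
  shows "integrable Q f_check \<and> integrable Q (\<lambda>\<omega>. (f_check \<omega>)\<^sup>2) \<and>
         prob_space.expectation Q f_check = m_fun K fX h x \<and>
         prob_space.variance Q f_check = v_fun K fX fU fW h n N x \<and>
         integrable P f_tilde \<and> integrable P (\<lambda>\<omega>. (f_tilde \<omega>)\<^sup>2) \<and>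
         prob_space.expectation P f_tilde = m_fun K fX h x \<and>
         prob_space.variance P f_tilde = v_fun K fX fU fW h n N x + w_fun K fX h n N x"
proof -

  \<comment> \<open>Laws of the generic variables and notation\<close>
  interpret R: prob_space R by (rule R)
  interpret P: prob_space P by (rule P)
  interpret Q: prob_space Q by (rule Q)
  note [measurable] = distributed_real_measurable [OF fX] distributed_real_measurable [OF fU]
    distributed_real_measurable [OF fW] borel_measurable_integrable [OF K(1)]
  define \<mu>X where "\<mu>X = density lborel (\<lambda>y. ennreal (fX y))"
  define \<mu>U where "\<mu>U = density lborel (\<lambda>y. ennreal (fU y))"
  define \<mu>W where "\<mu>W = density lborel (\<lambda>y. ennreal (fW y))"
  have rv [measurable]: "X\<^sub>0 \<in> borel_measurable R" "U\<^sub>0 \<in> borel_measurable R"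
    using distributed_measurable [OF fX(2)] distributed_measurable [OF fU(2)] by simp_all
  have law: "distr R borel X\<^sub>0 = \<mu>X" "distr R borel U\<^sub>0 = \<mu>U"
    "distr R borel (\<lambda>\<omega>. X\<^sub>0 \<omega> + U\<^sub>0 \<omega>) = \<mu>W"
    using distributed_distr_eq_density [OF fX(2)] distributed_distr_eq_density [OF fU(2)]
      distributed_distr_eq_density [OF fW(2)]
    by (simp_all add: \<mu>X_def \<mu>U_def \<mu>W_def cong: distr_cong)
  interpret \<mu>X: prob_space \<mu>X
    unfolding law(1) [symmetric] by (rule R.prob_space_distr) simp
  interpret \<mu>U: prob_space \<mu>U
    unfolding law(2) [symmetric] by (rule R.prob_space_distr) simp
  have [measurable_cong]: "sets \<mu>X = sets borel" "sets \<mu>U = sets borel" "sets \<mu>W = sets borel"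
    by (simp_all add: \<mu>X_def \<mu>U_def \<mu>W_def)

  define m where "m = m_fun K fX h x"
  define M where "M = real (total_obs n N)"
  define l where "l w = deconv_kernel K fU h ((x - w) / h)" for w
  \<comment> \<open>The conditional mean of \<open>l (X + U)\<close> given \<open>X = y\<close>. As
    an exact average it can be used pointwise when conditioning.\<close>
  define g where "g y = (\<integral>u. l (y + u) \<partial>\<mu>U)" for y
  define A where "A = (LBINT u. (deconv_kernel K fU h u)\<^sup>2 * fW (x - h * u))"
  define B where "B = (LBINT u. (K u)\<^sup>2 * fX (x - h * u))"
  have l_meas [measurable]: "l \<in> borel_measurable borel"
    unfolding l_def [abs_def] by measurable
  have g_meas [measurable]: "g \<in> borel_measurable borel"
    unfolding g_def [abs_def] by measurable
  obtain C where l_bound: "\<And>w. \<bar>l w\<bar> \<le> C"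
    using abs_deconv_kernel_le unfolding l_def by blast
  have l2_bound: "\<bar>(l w)\<^sup>2\<bar> \<le> C\<^sup>2" for w
    using power_mono [OF l_bound [of w], of 2] by simp
  have ll_bound: "\<bar>l v * l w\<bar> \<le> C\<^sup>2" for v w
    unfolding abs_mult power2_eq_square using l_bound order.trans [OF abs_ge_zero l_bound]
    by (intro mult_mono) auto

  \<comment> \<open>Equality up to a Lebesgue null set suffices, since \<open>\<mu>X\<close> has a
    density.\<close>
  have g_AE: "AE y in lborel. g y = K ((x - y) / h)"
    unfolding g_def l_def \<mu>U_def
    using K(1) K_ft(2) fU(1) fU_ft(2) h \<mu>U.prob_space_axioms
    by (intro smoothed_deconv_kernel_AE) (simp_all add: \<mu>U_def)

  \<comment> \<open>First and second moments of a single summand\<close>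
  have g_mean: "(\<integral>y. g y \<partial>\<mu>X) = h * m"
  proof -
    have "(\<integral>y. g y \<partial>\<mu>X) = (LBINT y. K ((x - y) / h) * fX y)"
      unfolding \<mu>X_def using fX(1) g_AE
      by (subst integral_density) (auto intro!: integral_cong_AE)
    then show ?thesis
      using h by (simp add: lborel_integral_rescale m_def m_fun_def)
  qed
  have g_sq: "(\<integral>y. (g y)\<^sup>2 \<partial>\<mu>X) = h * B"
  proof -
    have "(\<integral>y. (g y)\<^sup>2 \<partial>\<mu>X) = (LBINT y. (K ((x - y) / h))\<^sup>2 * fX y)"
      unfolding \<mu>X_def using fX(1) g_AE
      by (subst integral_density) (auto intro!: integral_cong_AE)
    then show ?thesis
      using h lborel_integral_rescale [of h "\<lambda>v. (K v)\<^sup>2" x fX] by (simp add: B_def)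
  qed
  \<comment> \<open>This ties \<open>fW\<close>, known only as a density of the sum, to the laws of
    its two terms.\<close>
  have sum_law: "(\<integral>w. \<psi> w \<partial>\<mu>W) = (\<integral>y. (\<integral>u. \<psi> (y + u) \<partial>\<mu>U) \<partial>\<mu>X)"
    if [measurable]: "\<psi> \<in> borel_measurable borel" and "\<And>w. \<bar>\<psi> w\<bar> \<le> D" for \<psi> :: "real \<Rightarrow> real" and D
    using R.expectation_indep_sum [OF indep that] unfolding law(3) [symmetric]
    by (subst integral_distr) (simp_all add: law)
  have l_mean: "(\<integral>w. l w \<partial>\<mu>W) = h * m"
    using sum_law [OF l_meas l_bound] g_mean by (simp add: g_def)
  have l_sq: "(\<integral>w. (l w)\<^sup>2 \<partial>\<mu>W) = h * A"
  proof -
    have "(\<integral>w. (l w)\<^sup>2 \<partial>\<mu>W) = (LBINT w. (deconv_kernel K fU h ((x - w) / h))\<^sup>2 * fW w)"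
      unfolding \<mu>W_def using fW(1)
      by (subst integral_density) (auto simp: l_def mult.commute)
    then show ?thesis
      using h lborel_integral_rescale [of h "\<lambda>v. (deconv_kernel K fU h v)\<^sup>2" x fW] by (simp add: A_def)
  qed

  have M: "0 < M"
  proof -
    have "N 1 \<le> total_obs n N"
      unfolding total_obs_def using n by (intro member_le_sum) auto
    then show ?thesis
      using N [of 1] n by (simp add: M_def)
  qed
  have v: "v_fun K fX fU fW h n N x = 1 / M * (1 / h * A - m\<^sup>2)"
    by (simp add: v_fun_def M_def A_def m_def)
  have w: "w_fun K fX h n N x = 2 * total_pairs n N / M\<^sup>2 * (1 / h * B - m\<^sup>2)"
    by (simp add: w_fun_def M_def B_def m_def)
  define c where "c = 1 / (M * h)"

  \<comment> \<open>The unreplicated estimator\<close>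
  have check: "integrable Q f_check \<and> integrable Q (\<lambda>\<omega>. (f_check \<omega>)\<^sup>2) \<and>
      Q.expectation f_check = m \<and> Q.variance f_check = v_fun K fX fU fW h n N x"
  proof -
    let ?I = "{1..total_obs n N}"
    define Z where "Z i \<omega> = l (W i \<omega>)" for i \<omega>
    have f: "f_check = (\<lambda>\<omega>. c * (\<Sum>i\<in>?I. Z i \<omega>))"
      by (simp add: f_check_def standard_estimator_def Z_def l_def c_def M_def)
    have W_rv [measurable]: "W i \<in> borel_measurable Q" if "i \<in> ?I" for i
      using W_indep that by (auto simp: Q.indep_vars_def)
    have Z_rv [measurable]: "Z i \<in> borel_measurable Q" if "i \<in> ?I" for i
      using W_rv [OF that] unfolding Z_def [abs_def] by measurable
    have Z_law: "Q.expectation (\<lambda>\<omega>. \<psi> (W i \<omega>)) = (\<integral>w. \<psi> w \<partial>\<mu>W)"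
      if "i \<in> ?I" and [measurable]: "\<psi> \<in> borel_measurable borel" for i and \<psi> :: "real \<Rightarrow> real"
      using W_rv [OF that(1)] unfolding law(3) [symmetric] W [OF that(1), symmetric]
      by (subst integral_distr) auto
    have Z_bound: "\<bar>Z i \<omega>\<bar> \<le> C" for i \<omega>
      by (simp add: Z_def l_bound)
    have Z_mean: "Q.expectation (Z i) = h * m" if "i \<in> ?I" for i
      using Z_law [OF that l_meas] l_mean by (simp add: Z_def [abs_def])
    have Z_int: "integrable Q (Z i)" if "i \<in> ?I" for i
      using that Z_bound by (intro Q.integrable_const_bound [where B = C]) auto
    have Z_cov: "Q.expectation (\<lambda>\<omega>. Z i \<omega> * Z j \<omega>) - (h * m)\<^sup>2 = (if j = i then h * A - (h * m)\<^sup>2 else 0)"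
      if ij: "i \<in> ?I" "j \<in> ?I" for i j
    proof (cases "j = i")
      case True
      then show ?thesis
        using Z_law [OF ij(1), of "\<lambda>w. (l w)\<^sup>2"] l_sq by (simp add: Z_def power2_eq_square)
    next
      case False
      have "Q.indep_var borel (W i) borel (W j)"
        using Q.indep_var_of_indep_vars [OF W_indep ij] False by simp
      then have "Q.indep_var borel (l \<circ> W i) borel (l \<circ> W j)"
        by (rule Q.indep_var_compose) measurable
      then have "Q.indep_var borel (Z i) borel (Z j)"
        by (simp add: Z_def [abs_def] comp_def)
      then have "Q.expectation (\<lambda>\<omega>. Z i \<omega> * Z j \<omega>) = h * m * (h * m)"
        using Q.indep_var_lebesgue_integral [OF _ Z_int [OF ij(1)] Z_int [OF ij(2)]]
        by (simp add: Z_mean [OF ij(1)] Z_mean [OF ij(2)])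
      then show ?thesis
        using False by (simp add: power2_eq_square)
    qed
    have fin: "finite ?I" by simp
    note moments = Q.scaled_sum_moments [of ?I Z C "h * m" c, OF fin Z_rv Z_bound Z_mean]
    have "Q.variance f_check = c\<^sup>2 * (\<Sum>i\<in>?I. \<Sum>j\<in>?I. Q.expectation (\<lambda>\<omega>. Z i \<omega> * Z j \<omega>) - (h * m)\<^sup>2)"
      unfolding f by (rule moments(4))
    also have "\<dots> = c\<^sup>2 * (\<Sum>i\<in>?I. \<Sum>j\<in>?I. if j = i then h * A - (h * m)\<^sup>2 else 0)"
      by (intro arg_cong [where f = "(*) (c\<^sup>2)"] sum.cong refl Z_cov)
    also have "\<dots> = c\<^sup>2 * (M * (h * A - (h * m)\<^sup>2))"
      by (simp add: M_def)
    also have "\<dots> = v_fun K fX fU fW h n N x"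
      using M h unfolding v c_def by (simp add: field_simps power2_eq_square)
    finally have "Q.variance f_check = v_fun K fX fU fW h n N x" .
    moreover have "integrable Q f_check"
      unfolding f by (rule moments(1))
    moreover have "integrable Q (\<lambda>\<omega>. (f_check \<omega>)\<^sup>2)"
      unfolding f by (rule moments(2))
    moreover have "Q.expectation f_check = c * (card ?I * (h * m))"
      unfolding f by (rule moments(3))
    then have "Q.expectation f_check = m"
      using M h by (simp add: c_def M_def)
    ultimately show ?thesis
      by simp
  qed

  \<comment> \<open>The replicated estimator\<close>
  have tilde: "integrable P f_tilde \<and> integrable P (\<lambda>\<omega>. (f_tilde \<omega>)\<^sup>2) \<and>
      P.expectation f_tilde = m \<and> P.variance f_tilde = v_fun K fX fU fW h n N x + w_fun K fX h n N x"
  proof -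
    let ?I = "SIGMA j:{1..n}. {1..N j}"
    define V where "V = case_sum X (\<lambda>(j, k). U j k)"
    have V: "P.indep_vars (\<lambda>_. borel) V ({1..n} <+> ?I)"
      using XU by (simp add: V_def)
    have V_simps [simp]: "V (Inl j) = X j" "V (Inr (j, k)) = U j k" for j k
      by (simp_all add: V_def)
    have V_rv: "V i \<in> borel_measurable P" if "i \<in> {1..n} <+> ?I" for i
      using V that by (auto simp: P.indep_vars_def)
    have X_rv: "X j \<in> borel_measurable P" if "j \<in> {1..n}" for j
      using V_rv [OF InlI [OF that]] by simp
    have U_rv: "U j k \<in> borel_measurable P" if "(j, k) \<in> ?I" for j k
      using V_rv [OF InrI [OF that]] by simp
    have XU_indep: "P.indep_var borel (X j) borel (U j k)" if "(j, k) \<in> ?I" for j k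
      using P.indep_var_of_indep_vars [OF V, of "Inl j" "Inr (j, k)"] that by (auto simp: Plus_def)
    define Z where "Z = (\<lambda>(j, k) \<omega>. l (X j \<omega> + U j k \<omega>))"
    have f: "f_tilde = (\<lambda>\<omega>. c * (\<Sum>i\<in>?I. Z i \<omega>))"
      by (simp add: f_tilde_def replicated_estimator_def Z_def l_def c_def M_def sum.Sigma split_beta')
    have Z_rv: "Z i \<in> borel_measurable P" if "i \<in> ?I" for i
    proof -
      obtain j k where i: "i = (j, k)" by (cases i)
      note [measurable] = X_rv [of j] U_rv [of j k]
      show ?thesis
        unfolding i Z_def using that i by (auto simp: case_prod_beta')
    qed
    have Z_bound: "\<bar>Z i \<omega>\<bar> \<le> C" for i \<omega>
      by (simp add: Z_def l_bound split: prod.split)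
    have Z_int: "integrable P (Z i)" if "i \<in> ?I" for i
      using Z_rv [OF that] Z_bound by (intro P.integrable_const_bound [where B = C]) auto
    have Z_law: "P.expectation (\<lambda>\<omega>. \<psi> (X j \<omega> + U j k \<omega>)) = (\<integral>w. \<psi> w \<partial>\<mu>W)"
      if jk: "(j, k) \<in> ?I" and \<psi>: "\<psi> \<in> borel_measurable borel" "\<And>w. \<bar>\<psi> w\<bar> \<le> D"
      for j k D and \<psi> :: "real \<Rightarrow> real"
      using P.expectation_indep_sum [OF XU_indep [OF jk] \<psi>] sum_law [OF \<psi>] X [of j] U [of j k] jk
      by (simp add: law)
    have Z_mean: "P.expectation (Z i) = h * m" if "i \<in> ?I" for i
      using Z_law [OF _ l_meas l_bound] l_mean that by (cases i) (simp add: Z_def)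
    have Z_same: "P.expectation (\<lambda>\<omega>. Z i \<omega> * Z i \<omega>) = h * A" if "i \<in> ?I" for i
      using Z_law [OF _ borel_measurable_power [OF l_meas] l2_bound] l_sq that by (cases i) (simp add: Z_def power2_eq_square)
    \<comment> \<open>Two successive averages: over \<open>U j k'\<close> with \<open>X j\<close>
      and \<open>U j k\<close> fixed, then over \<open>U j k\<close> with \<open>X j\<close> fixed.
      Each replaces one factor by \<open>g (X j \<omega>)\<close>.\<close>
    have Z_repl: "P.expectation (\<lambda>\<omega>. Z (j, k) \<omega> * Z (j, k') \<omega>) = h * B"
      if jk: "(j, k) \<in> ?I" "(j, k') \<in> ?I" and kk: "k \<noteq> k'" for j k k'
    proof -
      have j: "j \<in> {1..n}" using jk by simp
      note [measurable] = X_rv [OF j] U_rv [OF jk(1)] U_rv [OF jk(2)]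
      have cond: "P.expectation (\<lambda>\<omega>. l (y + U j i \<omega>)) = g y" if "(j, i) \<in> ?I" for y i
      proof -
        have "\<mu>U = distr P borel (U j i)"
          using U [of j i] that by (simp add: law)
        then show ?thesis
          using U_rv [OF that] by (simp add: g_def integral_distr)
      qed
      \<comment> \<open>\<open>U j k'\<close> is doubled so that both independent variables are
        pairs.\<close>
      have "P.indep_var (borel \<Otimes>\<^sub>M borel) (\<lambda>\<omega>. (X j \<omega>, U j k \<omega>)) (borel \<Otimes>\<^sub>M borel) (\<lambda>\<omega>. (U j k' \<omega>, U j k' \<omega>))"
        using P.indep_var_pairs [OF V, of "Inl j" "Inr (j, k)" "Inr (j, k')" "Inr (j, k')"] jk kk by (auto simp: Plus_def)
      from P.expectation_indep_var [OF this, of "\<lambda>(p, q). l (fst p + snd p) * l (fst p + fst q)" "C\<^sup>2"]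
      have "P.expectation (\<lambda>\<omega>. Z (j, k) \<omega> * Z (j, k') \<omega>) = P.expectation (\<lambda>\<omega>. l (X j \<omega> + U j k \<omega>) * g (X j \<omega>))"
        using ll_bound cond [OF jk(2)] by (simp add: Z_def split_beta')
      also have "\<dots> = P.expectation (\<lambda>\<omega>. g (X j \<omega>) * g (X j \<omega>))"
      proof -
        have g_bound: "\<bar>g y\<bar> \<le> C" for y
          unfolding g_def using l_bound
          by (intro order.trans [OF integral_abs_bound] \<mu>U.integral_le_const \<mu>U.integrable_const_bound [where B = C]) auto
        have "\<bar>l a * g b\<bar> \<le> C * C" for a b
          unfolding abs_mult using l_bound g_bound order.trans [OF abs_ge_zero l_bound]
          by (intro mult_mono) auto
        then show ?thesis
          using P.expectation_indep_var [OF XU_indep [OF jk(1)], of "\<lambda>(y, u). l (y + u) * g y" "C * C"]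
            cond [OF jk(1)] by (simp add: split_beta')
      qed
      also have "\<dots> = (\<integral>y. (g y)\<^sup>2 \<partial>\<mu>X)"
        unfolding law(1) [symmetric] X [OF j, symmetric]
        by (subst integral_distr) (auto simp: power2_eq_square)
      finally show ?thesis by (simp add: g_sq)
    qed
    have Z_indep: "P.expectation (\<lambda>\<omega>. Z (j, k) \<omega> * Z (j', k') \<omega>) = (h * m)\<^sup>2"
      if jk: "(j, k) \<in> ?I" "(j', k') \<in> ?I" and jj: "j \<noteq> j'" for j k j' k'
    proof -
      have "P.indep_var (borel \<Otimes>\<^sub>M borel) (\<lambda>\<omega>. (X j \<omega>, U j k \<omega>)) (borel \<Otimes>\<^sub>M borel) (\<lambda>\<omega>. (X j' \<omega>, U j' k' \<omega>))"
        using P.indep_var_pairs [OF V, of "Inl j" "Inr (j, k)" "Inl j'" "Inr (j', k')"] jk jj by (auto simp: Plus_def)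
      then have "P.indep_var borel ((\<lambda>p. l (fst p + snd p)) \<circ> (\<lambda>\<omega>. (X j \<omega>, U j k \<omega>)))
          borel ((\<lambda>p. l (fst p + snd p)) \<circ> (\<lambda>\<omega>. (X j' \<omega>, U j' k' \<omega>)))"
        by (rule P.indep_var_compose) measurable
      then have "P.indep_var borel (Z (j, k)) borel (Z (j', k'))"
        by (simp add: Z_def comp_def)
      then show ?thesis
        using P.indep_var_lebesgue_integral [OF _ Z_int [OF jk(1)] Z_int [OF jk(2)]]
        by (simp add: Z_mean [OF jk(1)] Z_mean [OF jk(2)] power2_eq_square)
    qed
    \<comment> \<open>\<open>a\<close> is the variance of one summand and \<open>b\<close> the
      covariance of two distinct replicates of the same \<open>X j\<close>.\<close>
    define a where "a = h * A - (h * m)\<^sup>2"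
    define b where "b = h * B - (h * m)\<^sup>2"
    \<comment> \<open>Each block carries \<open>b\<close> throughout and the correction
      \<open>a - b\<close> on its diagonal; in this nested form the sums collapse one index at a
      time.\<close>
    have Z_cov: "P.expectation (\<lambda>\<omega>. Z (j, k) \<omega> * Z (j', k') \<omega>) - (h * m)\<^sup>2
        = (if j' = j then b + (if k' = k then a - b else 0) else 0)"
      if "(j, k) \<in> ?I" "(j', k') \<in> ?I" for j k j' k'
      using that Z_same [of "(j, k)"] Z_repl [of j k k'] Z_indep [of j k j' k']
      by (auto simp: a_def b_def)
    have fin: "finite ?I" by simp
    note moments = P.scaled_sum_moments [of ?I Z C "h * m" c, OF fin Z_rv Z_bound Z_mean]
    have "P.variance f_tilde = c\<^sup>2 * (\<Sum>p\<in>?I. \<Sum>q\<in>?I. P.expectation (\<lambda>\<omega>. Z p \<omega> * Z q \<omega>) - (h * m)\<^sup>2)"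
      unfolding f by (rule moments(4))
    also have "(\<Sum>p\<in>?I. \<Sum>q\<in>?I. P.expectation (\<lambda>\<omega>. Z p \<omega> * Z q \<omega>) - (h * m)\<^sup>2)
        = (\<Sum>(j, k)\<in>?I. \<Sum>(j', k')\<in>?I. if j' = j then b + (if k' = k then a - b else 0) else 0)"
      using Z_cov by (intro sum.cong refl) (auto intro!: sum.cong)
    also have "\<dots> = (\<Sum>j=1..n. \<Sum>k=1..N j. \<Sum>j'=1..n. \<Sum>k'=1..N j'. if j' = j then b + (if k' = k then a - b else 0) else 0)"
      by (simp flip: sum.Sigma)
    also have "\<dots> = (\<Sum>j=1..n. \<Sum>k=1..N j. \<Sum>j'=1..n. if j' = j then N j * b + (a - b) else 0)"
      by (intro sum.cong refl) (auto simp: sum.distrib)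
    also have "\<dots> = (\<Sum>j=1..n. real (N j) * a + real (N j) * (real (N j) - 1) * b)"
      by (intro sum.cong refl) (auto simp: algebra_simps)
    also have "\<dots> = M * a + 2 * total_pairs n N * b"
      by (simp add: sum.distrib M_def total_obs_def total_pairs_def sum_distrib_right)
    finally have "P.variance f_tilde = c\<^sup>2 * (M * a + 2 * total_pairs n N * b)" .
    \<comment> \<open>Since \<open>c = 1 / (M * h)\<close>, the diagonal part \<open>M * a\<close>
      yields \<open>v_fun\<close> and the replicate part yields \<open>w_fun\<close>.\<close>
    also have "\<dots> = v_fun K fX fU fW h n N x + w_fun K fX h n N x"
      using M h unfolding v w c_def a_def b_def by (simp add: field_simps power2_eq_square)
    finally have "P.variance f_tilde = v_fun K fX fU fW h n N x + w_fun K fX h n N x" .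
    moreover have "integrable P f_tilde"
      unfolding f by (rule moments(1))
    moreover have "integrable P (\<lambda>\<omega>. (f_tilde \<omega>)\<^sup>2)"
      unfolding f by (rule moments(2))
    moreover have "P.expectation f_tilde = c * (card ?I * (h * m))"
      unfolding f by (rule moments(3))
    then have "P.expectation f_tilde = m"
      using M h by (simp add: c_def M_def total_obs_def)
    ultimately show ?thesis
      by simp
  qed
  show ?thesis
    using check tilde unfolding m_def by blast
qed

end
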